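(* Let $M\in\mathcal{M}$ be a boolean model over a finite set $X$ of categorical features, where the model class $\mathcal{M}$ is closed under conditioning, negation and conjunction, and let $x\in X$. Then the value $|\{e \text{ entity over } X : x \text{ is necessary for } M(e)\}|$ can be computed using $2$ calls to model counting for the class $\mathcal{M}$.
   Context: Each categorical feature $x\in X$ has a finite domain $\mathcal{D}_x$. An entity over $X$ is a function $e$ with $e(x)\in\mathcal{D}_x$ for all $x\in X$; $e_{x=b}$ denotes the entity obtained from $e$ by changing its value at $x$ to $b\in\mathcal{D}_x$. A boolean model over $X$ is a map $M$ from entities to $\{0,1\}$; $M$ accepts $e$ if $M(e)=1$. $M_{x=b}$ is the model with $M_{x=b}(e)=M(e_{x=b})$. Model counting for $\mathcal{M}$ is the problem of computing, given $M\in\mathcal{M}$, the number $CT(M)$ of entities accepted by $M$. A class $\mathcal{M}$ of boolean models is closed under conditioning if $M_{x=b}\in\mathcal{M}$ for every $M\in\mathcal{M}$, $x\in X$, $b\in\mathcal{D}_x$, computable in polynomial time from $M,x,b$; under negation if $\lnot M\equiv 1-M\in\mathcal{M}$ for every $M\in\mathcal{M}$, efficiently computable from $M$; under conjunction if $M_1\wedge M_2\in\mathcal{M}$ for all $M_1,M_2\in\mathcal{M}$, efficiently computable from $M_1,M_2$. A set $S\subseteq X$ is a reason for $M(e)$ if $M(e')=M(e)$ for every entity $e'$ with $e'(y)=e(y)$ for all $y\in S$. A sufficient reason is a reason that is minimal under inclusion. A feature $x$ is necessary for $M(e)$ if it belongs to every sufficient reason for $M(e)$. *)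

theory Defs
  imports Main "HOL-Library.FuncSet" "HOL-Library.Log_Nat"
begin

section \<open>Boolean models, reasons and necessary features\<close>

text \<open>
  The features are \<open>X\<close> and \<open>D x\<close> is the domain of \<open>x\<close>. Entities are extensional functions, so
  that entities that agree on \<open>X\<close> are equal. A model is only ever looked at on entities, and it
  accepts \<open>e\<close> if \<open>M e\<close> holds, so that \<open>True\<close> and \<open>False\<close> stand for 1 and 0.
\<close>

type_synonym ('f, 'v) boolean_model = "('f \<Rightarrow> 'v) \<Rightarrow> bool"

definition entities :: "'f set \<Rightarrow> ('f \<Rightarrow> 'v set) \<Rightarrow> ('f \<Rightarrow> 'v) set" where
  "entities X D = (\<Pi>\<^sub>E x\<in>X. D x)"

definition same_model ::
    "'f set \<Rightarrow> ('f \<Rightarrow> 'v set) \<Rightarrow> ('f, 'v) boolean_model \<Rightarrow> ('f, 'v) boolean_model \<Rightarrow> bool" where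
  "same_model X D M N \<longleftrightarrow> (\<forall>e\<in>entities X D. M e = N e)"

definition CT :: "'f set \<Rightarrow> ('f \<Rightarrow> 'v set) \<Rightarrow> ('f, 'v) boolean_model \<Rightarrow> nat" where
  "CT X D M = card {e \<in> entities X D. M e}"

definition condition :: "('f, 'v) boolean_model \<Rightarrow> 'f \<Rightarrow> 'v \<Rightarrow> ('f, 'v) boolean_model" where
  "condition M x b = (\<lambda>e. M (e(x := b)))"

definition is_reason ::
    "'f set \<Rightarrow> ('f \<Rightarrow> 'v set) \<Rightarrow> ('f, 'v) boolean_model \<Rightarrow> ('f \<Rightarrow> 'v) \<Rightarrow> 'f set \<Rightarrow> bool" where
  "is_reason X D M e S \<longleftrightarrow>
     S \<subseteq> X \<and> (\<forall>e'\<in>entities X D. (\<forall>y\<in>S. e' y = e y) \<longrightarrow> M e' = M e)"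

definition is_sufficient_reason ::
    "'f set \<Rightarrow> ('f \<Rightarrow> 'v set) \<Rightarrow> ('f, 'v) boolean_model \<Rightarrow> ('f \<Rightarrow> 'v) \<Rightarrow> 'f set \<Rightarrow> bool" where
  "is_sufficient_reason X D M e S \<longleftrightarrow>
     is_reason X D M e S \<and> (\<forall>T. T \<subset> S \<longrightarrow> \<not> is_reason X D M e T)"

definition necessary ::
    "'f set \<Rightarrow> ('f \<Rightarrow> 'v set) \<Rightarrow> ('f, 'v) boolean_model \<Rightarrow> ('f \<Rightarrow> 'v) \<Rightarrow> 'f \<Rightarrow> bool" where
  "necessary X D M e x \<longleftrightarrow> (\<forall>S. is_sufficient_reason X D M e S \<longrightarrow> x \<in> S)"


section \<open>A machine model with oracle calls\<close>

text \<open>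
  Programs transform binary trees with natural numbers at the leaves. Numbers are measured in
  binary, and every basic step is charged for the sizes of its input and of its output. All data
  that occur in a run are therefore no larger than the time charged, and each basic step takes
  polynomial time on a Turing machine, so that polynomial time in this model is the usual
  polynomial time.
\<close>

datatype datum = Atom nat | Node datum datum

fun dsize :: "datum \<Rightarrow> nat" where
  "dsize (Atom n) = 1 + floorlog 2 n"
| "dsize (Node a b) = 1 + dsize a + dsize b"

datatype basic =
  Copy | Const datum | Lft | Rgt | Is_Atom | Equal | Plus | Minus | Times | Divide | Less

fun apply_basic :: "basic \<Rightarrow> datum \<Rightarrow> datum option" where
  "apply_basic Copy v = Some v"
| "apply_basic (Const c) v = Some c"
| "apply_basic Lft (Node a b) = Some a"
| "apply_basic Rgt (Node a b) = Some b"
| "apply_basic Is_Atom (Atom n) = Some (Atom 1)"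
| "apply_basic Is_Atom (Node a b) = Some (Atom 0)"
| "apply_basic Equal (Node a b) = Some (Atom (of_bool (a = b)))"
| "apply_basic Plus (Node (Atom m) (Atom n)) = Some (Atom (m + n))"
| "apply_basic Minus (Node (Atom m) (Atom n)) = Some (Atom (m - n))"
| "apply_basic Times (Node (Atom m) (Atom n)) = Some (Atom (m * n))"
| "apply_basic Divide (Node (Atom m) (Atom n)) = Some (Atom (m div n))"
| "apply_basic Less (Node (Atom m) (Atom n)) = Some (Atom (of_bool (m < n)))"
| "apply_basic _ _ = None"

datatype program =
    Basic basic
  | Ask
  | Fork program program
  | Seq program program
  | Cond program program program
  | While program program

text \<open>
  \<open>exec Q p v w t n\<close>: on input \<open>v\<close> the program \<open>p\<close> terminates with output \<open>w\<close> in time \<open>t\<close> after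
  exactly \<open>n\<close> oracle calls. The oracle answers a query \<open>v\<close> by \<open>w\<close> if \<open>Q v w\<close>. A query without an
  answer blocks the run, so a terminating run has put only admissible queries.
\<close>

inductive exec ::
    "(datum \<Rightarrow> datum \<Rightarrow> bool) \<Rightarrow> program \<Rightarrow> datum \<Rightarrow> datum \<Rightarrow> nat \<Rightarrow> nat \<Rightarrow> bool"
  for Q :: "datum \<Rightarrow> datum \<Rightarrow> bool" where
  Basic: "apply_basic f v = Some w \<Longrightarrow> exec Q (Basic f) v w (1 + dsize v + dsize w) 0"
| Ask: "Q v w \<Longrightarrow> exec Q Ask v w (1 + dsize v + dsize w) 1"
| Fork: "exec Q p v a s m \<Longrightarrow> exec Q q v b t n \<Longrightarrow>
    exec Q (Fork p q) v (Node a b) (1 + s + t) (m + n)"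
| Seq: "exec Q p v u s m \<Longrightarrow> exec Q q u w t n \<Longrightarrow> exec Q (Seq p q) v w (1 + s + t) (m + n)"
| Cond_True: "exec Q c v u s m \<Longrightarrow> u \<noteq> Atom 0 \<Longrightarrow> exec Q p v w t n \<Longrightarrow>
    exec Q (Cond c p q) v w (1 + s + t) (m + n)"
| Cond_False: "exec Q c v (Atom 0) s m \<Longrightarrow> exec Q q v w t n \<Longrightarrow>
    exec Q (Cond c p q) v w (1 + s + t) (m + n)"
| While_True: "exec Q c v u r l \<Longrightarrow> u \<noteq> Atom 0 \<Longrightarrow> exec Q p v v' s m \<Longrightarrow>
    exec Q (While c p) v' w t n \<Longrightarrow> exec Q (While c p) v w (1 + r + s + t) (l + m + n)"
| While_False: "exec Q c v (Atom 0) s m \<Longrightarrow> exec Q (While c p) v v (1 + s) m"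

inductive_cases exec_BasicE: "exec Q (Basic f) v w t n"
inductive_cases exec_AskE: "exec Q Ask v w t n"
inductive_cases exec_ForkE: "exec Q (Fork p q) v w t n"
inductive_cases exec_SeqE: "exec Q (Seq p q) v w t n"
inductive_cases exec_CondE: "exec Q (Cond c p q) v w t n"
inductive_cases exec_WhileE: "exec Q (While c p) v w t n"

lemma exec_deterministic:
  assumes "\<And>v a b. Q v a \<Longrightarrow> Q v b \<Longrightarrow> a = b"
    and "exec Q p v w t n" "exec Q p v w' t' n'"
  shows "w' = w \<and> t' = t \<and> n' = n"
  using assms(2,3)
proof (induction arbitrary: w' t' n' rule: exec.induct)
  case (Basic f v w)
  from Basic.prems Basic.hyps show ?case
    by (auto elim!: exec_BasicE)
next
  case (Ask v w)
  from Ask.prems Ask.hyps show ?case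
    by (auto elim!: exec_AskE dest: assms(1))
next
  case (Fork p v a s m q b t n)
  from Fork.prems show ?case
    by (auto elim!: exec_ForkE dest!: Fork.IH)
next
  case (Seq p v u s m q w t n)
  from Seq.prems show ?case
    by (auto elim!: exec_SeqE dest!: Seq.IH)
next
  case (Cond_True c v u s m p w t n q)
  from Cond_True.prems Cond_True.hyps show ?case
    by (auto elim!: exec_CondE dest!: Cond_True.IH)
next
  case (Cond_False c v s m q w t n p)
  from Cond_False.prems show ?case
    by (auto elim!: exec_CondE dest!: Cond_False.IH)
next
  case (While_True c v u r l p v' s m w t n)
  from While_True.prems While_True.hyps show ?case
    by (auto elim!: exec_WhileE dest!: While_True.IH)
next
  case (While_False c v s m p)
  from While_False.prems show ?case
    by (auto elim!: exec_WhileE dest!: While_False.IH)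
qed

lemma dsize_le_time: "exec Q p v w t n \<Longrightarrow> dsize v \<le> t \<and> dsize w \<le> t"
  by (induction rule: exec.induct) auto

text \<open>A problem is a set of instances, each given together with the set of its correct answers.\<close>

type_synonym problem = "(datum \<times> datum set) set"

definition solves_in_poly_time ::
    "(datum \<Rightarrow> datum \<Rightarrow> bool) \<Rightarrow> nat \<Rightarrow> program \<Rightarrow> problem \<Rightarrow> bool" where
  "solves_in_poly_time Q n p P \<longleftrightarrow>
     (\<exists>k. \<forall>(v, A)\<in>P. \<exists>w\<in>A. \<exists>t. exec Q p v w t n \<and> t \<le> k * dsize v ^ k)"

definition no_oracle :: "datum \<Rightarrow> datum \<Rightarrow> bool" where
  "no_oracle v w \<longleftrightarrow> False"

definition poly_time_solvable :: "problem \<Rightarrow> bool" where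
  "poly_time_solvable P \<longleftrightarrow> (\<exists>p. solves_in_poly_time no_oracle 0 p P)"

definition oracle_for :: "problem \<Rightarrow> datum \<Rightarrow> datum \<Rightarrow> bool" where
  "oracle_for P v w \<longleftrightarrow> (\<exists>A. (v, A) \<in> P \<and> w \<in> A)"


section \<open>Classes of boolean models\<close>

text \<open>
  In inputs of algorithms, features and their values are named by numbers. Requiring \<open>D\<close> to be
  extensional makes the encoding below injective.
\<close>

definition feature_space :: "nat set \<Rightarrow> (nat \<Rightarrow> nat set) \<Rightarrow> bool" where
  "feature_space X D \<longleftrightarrow> finite X \<and> (\<forall>x\<in>X. finite (D x)) \<and> D \<in> extensional X"

text \<open>
  A class of models is given by the codes of its models over each feature space, with the models
  that they denote; a model may have several codes.
\<close>

record model_class =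
  codes :: "nat set \<Rightarrow> (nat \<Rightarrow> nat set) \<Rightarrow> datum set"
  model :: "nat set \<Rightarrow> (nat \<Rightarrow> nat set) \<Rightarrow> datum \<Rightarrow> (nat, nat) boolean_model"

definition codes_of ::
    "model_class \<Rightarrow> nat set \<Rightarrow> (nat \<Rightarrow> nat set) \<Rightarrow> (nat, nat) boolean_model \<Rightarrow> datum set" where
  "codes_of \<M> X D M = {m \<in> codes \<M> X D. same_model X D (model \<M> X D m) M}"

fun enc_list :: "datum list \<Rightarrow> datum" where
  "enc_list [] = Atom 0"
| "enc_list (v # vs) = Node v (enc_list vs)"

definition enc_space :: "nat set \<Rightarrow> (nat \<Rightarrow> nat set) \<Rightarrow> datum" where
  "enc_space X D =
     enc_list (map (\<lambda>x. Node (Atom x) (enc_list (map Atom (sorted_list_of_set (D x)))))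
       (sorted_list_of_set X))"

definition model_counting :: "model_class \<Rightarrow> problem" where
  "model_counting \<M> =
     {(Node (enc_space X D) m, {Atom (CT X D (model \<M> X D m))}) | X D m.
       feature_space X D \<and> m \<in> codes \<M> X D}"

definition closed_under_conditioning :: "model_class \<Rightarrow> bool" where
  "closed_under_conditioning \<M> \<longleftrightarrow> poly_time_solvable
     {(Node (Node (enc_space X D) m) (Node (Atom x) (Atom b)),
       codes_of \<M> X D (condition (model \<M> X D m) x b)) | X D m x b.
       feature_space X D \<and> m \<in> codes \<M> X D \<and> x \<in> X \<and> b \<in> D x}"

definition closed_under_negation :: "model_class \<Rightarrow> bool" where
  "closed_under_negation \<M> \<longleftrightarrow> poly_time_solvable
     {(Node (enc_space X D) m, codes_of \<M> X D (\<lambda>e. \<not> model \<M> X D m e)) | X D m.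
       feature_space X D \<and> m \<in> codes \<M> X D}"

definition closed_under_conjunction :: "model_class \<Rightarrow> bool" where
  "closed_under_conjunction \<M> \<longleftrightarrow> poly_time_solvable
     {(Node (enc_space X D) (Node m1 m2),
       codes_of \<M> X D (\<lambda>e. model \<M> X D m1 e \<and> model \<M> X D m2 e)) | X D m1 m2.
       feature_space X D \<and> m1 \<in> codes \<M> X D \<and> m2 \<in> codes \<M> X D}"

text \<open>
  The parameter \<open>d\<close> bounds the domain size of the distinguished feature. It does not restrict
  which instances have to be solved by a program that solves the problem for every \<open>d\<close>, but the
  polynomial may then depend on \<open>d\<close>. This is unavoidable: as conjunction is binary and may enlarge
  codes by a polynomial factor, the size of a conjunction of \<open>d\<close> models may be exponential in \<open>d\<close>.
\<close>

definition necessity_counting :: "model_class \<Rightarrow> nat \<Rightarrow> problem" where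
  "necessity_counting \<M> d =
     {(Node (Node (enc_space X D) m) (Atom x),
       {Atom (card {e \<in> entities X D. necessary X D (model \<M> X D m) e x})}) | X D m x.
       feature_space X D \<and> m \<in> codes \<M> X D \<and> x \<in> X \<and> card (D x) \<le> d}"

lemma enc_list_inject: "enc_list vs = enc_list ws \<Longrightarrow> vs = ws"
proof (induction vs arbitrary: ws)
  case Nil
  then show ?case by (cases ws) auto
next
  case (Cons v vs)
  then show ?case by (cases ws) auto
qed

lemma enc_space_inject:
  assumes X: "feature_space X D" and Y: "feature_space Y E"
    and eq: "enc_space X D = enc_space Y E"
  shows "X = Y \<and> D = E"
proof -
  let ?f = "\<lambda>D x. Node (Atom x) (enc_list (map Atom (sorted_list_of_set (D x))))"
  let ?name = "\<lambda>v. case v of Node (Atom x) _ \<Rightarrow> x | _ \<Rightarrow> (0::nat)"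
  have m: "map (?f D) (sorted_list_of_set X) = map (?f E) (sorted_list_of_set Y)"
    using eq unfolding enc_space_def by (rule enc_list_inject)
  have "map ?name (map (?f D) (sorted_list_of_set X)) = map ?name (map (?f E) (sorted_list_of_set Y))"
    using m by (rule arg_cong)
  then have "sorted_list_of_set X = sorted_list_of_set Y"
    by (simp add: comp_def)
  moreover have fin: "finite X" "finite Y"
    using X Y by (auto simp: feature_space_def)
  ultimately have XY: "X = Y"
    by (metis sorted_list_of_set.set_sorted_key_list_of_set)
  have "D x = E x" if "x \<in> X" for x
  proof -
    have "?f D x = ?f E x"
      using m that fin by (simp add: XY)
    then have "enc_list (map Atom (sorted_list_of_set (D x)))
        = enc_list (map Atom (sorted_list_of_set (E x)))"
      by simp
    then have "map Atom (sorted_list_of_set (D x)) = map Atom (sorted_list_of_set (E x))"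
      by (rule enc_list_inject)
    then have "sorted_list_of_set (D x) = sorted_list_of_set (E x)"
      by (metis datum.inject(1) injI inj_map_eq_map)
    moreover have "finite (D x)" "finite (E x)"
      using X Y that XY by (auto simp: feature_space_def)
    ultimately show ?thesis
      by (metis sorted_list_of_set.set_sorted_key_list_of_set)
  qed
  then have "D = E"
    using X Y XY by (auto simp: feature_space_def intro!: extensionalityI[of D X E])
  with XY show ?thesis by blast
qed

lemma oracle_for_model_counting_functional:
  assumes "oracle_for (model_counting \<M>) v a" "oracle_for (model_counting \<M>) v b"
  shows "a = b"
  using assms unfolding oracle_for_def model_counting_def by (auto dest: enc_space_inject)

end

(*
  x is necessary for M(e) iff M(e_{x=b}) differs from M(e) for some b in D x: the set X - {x} is then
  not a reason, and every reason that omits x is contained in it. Let A be the conjunction of M and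
  all M_{x=b}, and let B be built in the same way from the negation of M. Then the entities in
  question are those accepted by the negation of B but not by A, and every entity accepted by A is
  accepted by the negation of B, so their number is CT(not B) - CT(A). Starting both conjunctions
  with the model itself does not change them on entities, and covers an empty D x.
  The conjunctions are built by a loop with at most d rounds, each of which replaces the size
  of the current code by a polynomial in it, so the running time is polynomial for fixed d.
*)

theory Submission
  imports Defs
begin

section \<open>Polynomially bounded running times\<close>

lemma dsize_pos: "1 \<le> dsize v"
  by (cases v) auto

definition poly_bounded :: "'i set \<Rightarrow> ('i \<Rightarrow> datum) \<Rightarrow> ('i \<Rightarrow> nat) \<Rightarrow> bool" where
  "poly_bounded I f s \<longleftrightarrow> (\<exists>k. \<forall>i\<in>I. s i \<le> k * dsize (f i) ^ k)"

text \<open>Sizes are at least 1, so enlarging the exponent never lowers a power, and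
  \<open>c + e\<close> can serve both as factor and as exponent.\<close>

lemma poly_boundedI:
  assumes "\<And>i. i \<in> I \<Longrightarrow> s i \<le> c * dsize (f i) ^ e"
  shows "poly_bounded I f s"
  unfolding poly_bounded_def
proof (intro exI ballI)
  fix i assume i: "i \<in> I"
  have "c * dsize (f i) ^ e \<le> (c + e) * dsize (f i) ^ (c + e)"
    using dsize_pos[of "f i"] by (intro mult_mono power_increasing) auto
  with assms[OF i] show "s i \<le> (c + e) * dsize (f i) ^ (c + e)" by linarith
qed

lemma poly_bounded_mono:
  assumes "poly_bounded I f s" "\<And>i. i \<in> J \<Longrightarrow> r i \<le> s i" "J \<subseteq> I"
  shows "poly_bounded J f r"
  using assms unfolding poly_bounded_def by (meson order_trans subsetD)

lemma poly_bounded_const: "poly_bounded I f (\<lambda>_. c)"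
  by (rule poly_boundedI[where c = c and e = 0]) simp

lemma poly_bounded_dsize: "poly_bounded I f (\<lambda>i. dsize (f i))"
  by (rule poly_boundedI[where c = 1 and e = 1]) simp

lemma poly_bounded_add:
  assumes "poly_bounded I f s" "poly_bounded I f r"
  shows "poly_bounded I f (\<lambda>i. s i + r i)"
proof -
  obtain k l where k: "\<And>i. i \<in> I \<Longrightarrow> s i \<le> k * dsize (f i) ^ k"
    and l: "\<And>i. i \<in> I \<Longrightarrow> r i \<le> l * dsize (f i) ^ l"
    using assms unfolding poly_bounded_def by blast
  show ?thesis
  proof (rule poly_boundedI)
    fix i assume i: "i \<in> I"
    have "k * dsize (f i) ^ k \<le> k * dsize (f i) ^ (k + l)" "l * dsize (f i) ^ l \<le> l * dsize (f i) ^ (k + l)"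
      using dsize_pos[of "f i"] by (intro mult_left_mono power_increasing; simp)+
    with k[OF i] l[OF i] show "s i + r i \<le> (k + l) * dsize (f i) ^ (k + l)"
      unfolding add_mult_distrib by linarith
  qed
qed

lemma poly_bounded_mult:
  assumes "poly_bounded I f s" "poly_bounded I f r"
  shows "poly_bounded I f (\<lambda>i. s i * r i)"
proof -
  obtain k l where k: "\<And>i. i \<in> I \<Longrightarrow> s i \<le> k * dsize (f i) ^ k"
    and l: "\<And>i. i \<in> I \<Longrightarrow> r i \<le> l * dsize (f i) ^ l"
    using assms unfolding poly_bounded_def by blast
  show ?thesis
  proof (rule poly_boundedI)
    fix i assume i: "i \<in> I"
    have "s i * r i \<le> (k * dsize (f i) ^ k) * (l * dsize (f i) ^ l)"
      using k[OF i] l[OF i] by (rule mult_mono) auto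
    then show "s i * r i \<le> (k * l) * dsize (f i) ^ (k + l)"
      by (simp add: power_add mult_ac)
  qed
qed

text \<open>Substituting one polynomial into another gives a polynomial. This carries the time bound
  of a later step, stated in the size of its own input, back to the original input.\<close>

lemma poly_bounded_trans:
  assumes "poly_bounded I f (\<lambda>i. dsize (g i))" "poly_bounded I g s"
  shows "poly_bounded I f s"
proof -
  obtain k l where k: "\<And>i. i \<in> I \<Longrightarrow> dsize (g i) \<le> k * dsize (f i) ^ k"
    and l: "\<And>i. i \<in> I \<Longrightarrow> s i \<le> l * dsize (g i) ^ l"
    using assms unfolding poly_bounded_def by blast
  show ?thesis
  proof (rule poly_boundedI)
    fix i assume i: "i \<in> I"
    have "dsize (g i) ^ l \<le> (k * dsize (f i) ^ k) ^ l"
      using k[OF i] by (rule power_mono) simp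
    then have "l * dsize (g i) ^ l \<le> l * (k * dsize (f i) ^ k) ^ l"
      by (rule mult_left_mono) simp
    with l[OF i] have "s i \<le> l * (k * dsize (f i) ^ k) ^ l"
      by (rule order_trans)
    then show "s i \<le> (l * k ^ l) * dsize (f i) ^ (k * l)"
      by (simp add: power_mult_distrib power_mult mult_ac)
  qed
qed

lemmas poly_bounded_intros =
  poly_bounded_add poly_bounded_mult poly_bounded_const poly_bounded_dsize

section \<open>Families of polynomial-time runs\<close>

text \<open>
  \<open>f i\<close> and \<open>g i\<close> are the input and the output of the \<open>i\<close>-th run. One polynomial serves all of
  \<open>I\<close>, and it may depend on \<open>I\<close>: this is how the bound on the domain sizes enters.
\<close>

definition computes ::
    "(datum \<Rightarrow> datum \<Rightarrow> bool) \<Rightarrow> nat \<Rightarrow> program \<Rightarrow> 'i set \<Rightarrow> ('i \<Rightarrow> datum) \<Rightarrow> ('i \<Rightarrow> datum) \<Rightarrow> bool" where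
  "computes Q n p I f g \<longleftrightarrow>
     (\<exists>t. (\<forall>i\<in>I. exec Q p (f i) (g i) (t i) n) \<and> poly_bounded I f t)"

lemma computesE:
  assumes "computes Q n p I f g"
  obtains t where "\<And>i. i \<in> I \<Longrightarrow> exec Q p (f i) (g i) (t i) n" "poly_bounded I f t"
  using assms unfolding computes_def by blast

text \<open>Producing the output is charged for, by \<open>dsize_le_time\<close>, so a time bound is
  also a size bound.\<close>

lemma computes_dsize:
  assumes "computes Q n p I f g"
  shows "poly_bounded I f (\<lambda>i. dsize (g i))"
proof -
  obtain t where t: "\<And>i. i \<in> I \<Longrightarrow> exec Q p (f i) (g i) (t i) n" "poly_bounded I f t"
    using assms by (rule computesE) blast
  show ?thesis
    using t(2) by (rule poly_bounded_mono) (use dsize_le_time[OF t(1)] in auto)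
qed

lemma computesI:
  assumes "\<And>i. i \<in> I \<Longrightarrow> exec Q p (f i) (g i) (t i) n" "poly_bounded I f t"
  shows "computes Q n p I f g"
  using assms unfolding computes_def by blast

text \<open>The rules for runs match the syntactic form of input and output; this one changes the
  form, where only the values on the family matter.\<close>

lemma computes_cong:
  assumes "computes Q n p I f g" "\<And>i. i \<in> J \<Longrightarrow> f' i = f i" "\<And>i. i \<in> J \<Longrightarrow> g' i = g i" "J \<subseteq> I"
  shows "computes Q n p J f' g'"
  using assms unfolding computes_def poly_bounded_def by (metis subsetD)

lemma computes_empty: "computes Q n p {} f g"
  by (simp add: computes_def poly_bounded_def)

lemma computes_Seq:
  assumes "computes Q m p I f g" "computes Q n q I g h"
  shows "computes Q (m + n) (Seq p q) I f h"
proof -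
  obtain s where s: "\<And>i. i \<in> I \<Longrightarrow> exec Q p (f i) (g i) (s i) m" "poly_bounded I f s"
    using assms(1) by (rule computesE) blast
  obtain t where t: "\<And>i. i \<in> I \<Longrightarrow> exec Q q (g i) (h i) (t i) n" "poly_bounded I g t"
    using assms(2) by (rule computesE) blast
  show ?thesis
  proof (rule computesI)
    show "exec Q (Seq p q) (f i) (h i) (1 + s i + t i) (m + n)" if "i \<in> I" for i
      using s(1)[OF that] t(1)[OF that] by (rule exec.Seq)
    show "poly_bounded I f (\<lambda>i. 1 + s i + t i)"
      \<comment> \<open>The bound for \<open>q\<close> is in the size of \<open>g i\<close>, which
        \<open>computes_dsize\<close> bounds by a polynomial in the size of
        \<open>f i\<close>.\<close>
      by (intro poly_bounded_intros s(2) poly_bounded_trans[OF computes_dsize[OF assms(1)] t(2)])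
  qed
qed

lemma computes_Fork:
  assumes "computes Q m p I f g" "computes Q n q I f h"
  shows "computes Q (m + n) (Fork p q) I f (\<lambda>i. Node (g i) (h i))"
proof -
  obtain s where s: "\<And>i. i \<in> I \<Longrightarrow> exec Q p (f i) (g i) (s i) m" "poly_bounded I f s"
    using assms(1) by (rule computesE) blast
  obtain t where t: "\<And>i. i \<in> I \<Longrightarrow> exec Q q (f i) (h i) (t i) n" "poly_bounded I f t"
    using assms(2) by (rule computesE) blast
  show ?thesis
  proof (rule computesI)
    show "exec Q (Fork p q) (f i) (Node (g i) (h i)) (1 + s i + t i) (m + n)" if "i \<in> I" for i
      using s(1)[OF that] t(1)[OF that] by (rule exec.Fork)
    show "poly_bounded I f (\<lambda>i. 1 + s i + t i)"
      by (intro poly_bounded_intros s(2) t(2))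
  qed
qed

lemma computes_Seq0: "computes Q 0 p I f g \<Longrightarrow> computes Q n q I g h \<Longrightarrow> computes Q n (Seq p q) I f h"
  using computes_Seq[of Q 0 p I f g n q h] by simp

lemma computes_Fork0:
  "computes Q 0 p I f g \<Longrightarrow> computes Q 0 q I f h \<Longrightarrow> computes Q 0 (Fork p q) I f (\<lambda>i. Node (g i) (h i))"
  using computes_Fork[of Q 0 p I f g 0 q h] by simp

section \<open>Runs of the basic steps\<close>

lemma computes_Basic:
  assumes "\<And>i. i \<in> I \<Longrightarrow> apply_basic b (f i) = Some (g i)"
    and "\<And>i. i \<in> I \<Longrightarrow> dsize (g i) \<le> c + dsize (f i)"
  shows "computes Q 0 (Basic b) I f g"
proof (rule computesI)
  show "exec Q (Basic b) (f i) (g i) (1 + dsize (f i) + dsize (g i)) 0" if "i \<in> I" for i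
    using assms(1)[OF that] by (rule exec.Basic)
  have "poly_bounded I f (\<lambda>i. dsize (g i))"
    by (rule poly_bounded_mono[where s = "\<lambda>i. c + dsize (f i)" and I = I])
      (auto intro!: poly_bounded_intros assms(2))
  then show "poly_bounded I f (\<lambda>i. 1 + dsize (f i) + dsize (g i))"
    by (intro poly_bounded_intros)
qed

lemma computes_Copy: "computes Q 0 (Basic Copy) I f f"
  by (rule computes_Basic[where c = 0]) auto

lemma computes_Const: "computes Q 0 (Basic (Const a)) I f (\<lambda>_. a)"
  by (rule computes_Basic[where c = "dsize a"]) auto

lemma computes_Lft: "computes Q 0 (Basic Lft) I (\<lambda>i. Node (f i) (g i)) f"
  by (rule computes_Basic[where c = 0]) auto

lemma computes_Rgt: "computes Q 0 (Basic Rgt) I (\<lambda>i. Node (f i) (g i)) g"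
  by (rule computes_Basic[where c = 0]) auto

lemma computes_Equal:
  "computes Q 0 (Basic Equal) I (\<lambda>i. Node (f i) (g i)) (\<lambda>i. Atom (of_bool (f i = g i)))"
  by (rule computes_Basic[where c = 2]) (auto simp: of_bool_def floorlog_def)

lemma computes_Minus:
  "computes Q 0 (Basic Minus) I (\<lambda>i. Node (Atom (a i)) (Atom (b i))) (\<lambda>i. Atom (a i - b i))"
  by (rule computes_Basic[where c = 0]) (simp_all add: floorlog_mono trans_le_add1 le_SucI)

text \<open>\<open>Equal\<close> reports when a loop should stop, whereas \<open>While\<close>
  continues on a nonzero answer.\<close>

definition negate :: "program \<Rightarrow> program" where
  "negate p = Cond p (Basic (Const (Atom 0))) (Basic (Const (Atom 1)))"

lemma computes_negate:
  assumes "computes Q 0 p I f (\<lambda>i. Atom (of_bool (P i)))"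
  shows "computes Q 0 (negate p) I f (\<lambda>i. Atom (of_bool (\<not> P i)))"
proof -
  obtain s where s: "\<And>i. i \<in> I \<Longrightarrow> exec Q p (f i) (Atom (of_bool (P i))) (s i) 0" "poly_bounded I f s"
    using assms by (rule computesE) blast
  define t where "t = (\<lambda>i. 1 + s i + (1 + dsize (f i) + dsize (Atom (of_bool (\<not> P i)))))"
  show ?thesis
  proof (rule computesI)
    fix i assume i: "i \<in> I"
    have "exec Q (negate p) (f i) (Atom (of_bool (\<not> P i))) (t i) (0 + 0)"
    proof (cases "P i")
      case True
      with s(1)[OF i] show ?thesis
        unfolding negate_def t_def
        by (intro exec.Cond_True[where u = "Atom 1"] exec.Basic) auto
    next
      case False
      with s(1)[OF i] show ?thesis
        unfolding negate_def t_def by (intro exec.Cond_False exec.Basic) auto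
    qed
    then show "exec Q (negate p) (f i) (Atom (of_bool (\<not> P i))) (t i) 0" by simp
  next
    have "poly_bounded I f (\<lambda>i. 1 + s i + (1 + dsize (f i) + 2))"
      by (intro poly_bounded_intros s(2))
    then show "poly_bounded I f t"
      by (rule poly_bounded_mono) (auto simp: t_def of_bool_def floorlog_def)
  qed
qed

lemmas computes_intros = computes_Seq0 computes_Fork0 computes_Copy computes_Const computes_Lft
  computes_Rgt computes_Equal computes_negate

section \<open>Running times of loops\<close>

text \<open>Unfolds one round. The instances that need it form a subfamily, on which the rest of the
  loop is again a family of runs. Each use composes polynomials, so repeating it suits a number of
  rounds bounded over the whole family; in return the state may grow.\<close>

lemma computes_While:
  assumes c: "computes Q 0 c I f (\<lambda>i. Atom (of_bool (P i)))"
    and p: "computes Q 0 p {i\<in>I. P i} f f'"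
    and w: "computes Q 0 (While c p) {i\<in>I. P i} f' g"
    and g: "\<And>i. i \<in> I \<Longrightarrow> \<not> P i \<Longrightarrow> g i = f i"
  shows "computes Q 0 (While c p) I f g"
proof -
  obtain r where r: "\<And>i. i \<in> I \<Longrightarrow> exec Q c (f i) (Atom (of_bool (P i))) (r i) 0" "poly_bounded I f r"
    using c by (rule computesE) blast
  obtain s where s: "\<And>i. i \<in> {i\<in>I. P i} \<Longrightarrow> exec Q p (f i) (f' i) (s i) 0"
    "poly_bounded {i\<in>I. P i} f s"
    using p by (rule computesE) blast
  obtain t where t: "\<And>i. i \<in> {i\<in>I. P i} \<Longrightarrow> exec Q (While c p) (f' i) (g i) (t i) 0"
    "poly_bounded {i\<in>I. P i} f' t"
    using w by (rule computesE) blast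
  \<comment> \<open>The value 0 is for instances that leave the loop at the first test.\<close>
  define u where "u = (\<lambda>i. if P i then s i + t i else 0)"
  have "poly_bounded {i\<in>I. P i} f (\<lambda>i. s i + t i)"
    by (intro poly_bounded_intros s(2) poly_bounded_trans[OF computes_dsize[OF p] t(2)])
  then have u: "poly_bounded I f u"
    unfolding poly_bounded_def u_def by auto
  show ?thesis
  proof (rule computesI)
    show "exec Q (While c p) (f i) (g i) (1 + r i + u i) 0" if i: "i \<in> I" for i
    proof (cases "P i")
      case True
      then have "exec Q (While c p) (f i) (g i) (1 + r i + s i + t i) (0 + 0 + 0)"
        using r(1)[OF i] s(1)[of i] t(1)[of i] i
        by (intro exec.While_True[where u = "Atom 1" and v' = "f' i"]) auto
      with True show ?thesis by (simp add: u_def add.assoc)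
    next
      case False
      then show ?thesis
        using r(1)[OF i] g[OF i] by (auto simp: u_def intro!: exec.While_False[simplified])
    qed
    show "poly_bounded I f (\<lambda>i. 1 + r i + u i)"
      by (intro poly_bounded_intros r(2) u)
  qed
qed

text \<open>The test is run in \<open>N + 1\<close> states and the body in all but the last, hence
  the case distinction in the sum.\<close>

lemma exec_While_iterate:
  assumes "\<And>j. j \<le> N \<Longrightarrow> exec Q c (s j) (Atom (of_bool (j < N))) (r j) 0"
    and "\<And>j. j < N \<Longrightarrow> exec Q p (s j) (s (Suc j)) (t j) 0"
  shows "exec Q (While c p) (s 0) (s N) (\<Sum>j\<le>N. 1 + r j + (if j < N then t j else 0)) 0"
  using assms
proof (induction N arbitrary: s r t)
  case 0
  then show ?case using exec.While_False[of Q c "s 0" "r 0" 0 p] by simp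
next
  case (Suc N)
  have "exec Q (While c p) (s (Suc 0)) (s (Suc N))
      (\<Sum>j\<le>N. 1 + r (Suc j) + (if j < N then t (Suc j) else 0)) 0"
    using Suc.prems(1)[of "Suc _"] Suc.prems(2)[of "Suc _"]
    by (intro Suc.IH[of "\<lambda>j. s (Suc j)"]) auto
  moreover have "exec Q c (s 0) (Atom 1) (r 0) 0" "exec Q p (s 0) (s (Suc 0)) (t 0) 0"
    using Suc.prems(1)[of 0] Suc.prems(2)[of 0] by simp_all
  ultimately have "exec Q (While c p) (s 0) (s (Suc N))
      (1 + r 0 + t 0 + (\<Sum>j\<le>N. 1 + r (Suc j) + (if j < N then t (Suc j) else 0))) (0 + 0 + 0)"
    by (intro exec.While_True[where u = "Atom 1"]) auto
  moreover have "(\<Sum>j\<le>Suc N. 1 + r j + (if j < Suc N then t j else 0)) =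
      1 + r 0 + t 0 + (\<Sum>j\<le>N. 1 + r (Suc j) + (if j < N then t (Suc j) else 0))"
    by (subst sum.atMost_Suc_shift) simp
  ultimately show ?case by (simp only: add_0)
qed

text \<open>Here the number of rounds may vary without bound over \<open>I\<close>, but no state is
  larger than the first. Indexing the rounds by pairs \<open>(i, j)\<close> gives one polynomial for
  all of them, and the total is at most the number of tests times the bound for one round.\<close>

lemma computes_While_iterate:
  fixes s :: "'i \<Rightarrow> nat \<Rightarrow> datum"
  assumes c: "computes Q 0 c {(i, j). i \<in> I \<and> j \<le> N i} (\<lambda>(i, j). s i j)
      (\<lambda>(i, j). Atom (of_bool (j < N i)))"
    and p: "computes Q 0 p {(i, j). i \<in> I \<and> j < N i} (\<lambda>(i, j). s i j) (\<lambda>(i, j). s i (Suc j))"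
    and size: "\<And>i j. i \<in> I \<Longrightarrow> j \<le> N i \<Longrightarrow> dsize (s i j) \<le> dsize (s i 0)"
    and iterations: "poly_bounded I (\<lambda>i. s i 0) N"
  shows "computes Q 0 (While c p) I (\<lambda>i. s i 0) (\<lambda>i. s i (N i))"
proof -
  obtain r where r: "\<And>i j. i \<in> I \<Longrightarrow> j \<le> N i \<Longrightarrow> exec Q c (s i j) (Atom (of_bool (j < N i))) (r (i, j)) 0"
    and r': "poly_bounded {(i, j). i \<in> I \<and> j \<le> N i} (\<lambda>(i, j). s i j) r"
    using c unfolding computes_def by fastforce
  obtain t where t: "\<And>i j. i \<in> I \<Longrightarrow> j < N i \<Longrightarrow> exec Q p (s i j) (s i (Suc j)) (t (i, j)) 0"
    and t': "poly_bounded {(i, j). i \<in> I \<and> j < N i} (\<lambda>(i, j). s i j) t"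
    using p unfolding computes_def by fastforce
  obtain k where k: "\<And>i j. i \<in> I \<Longrightarrow> j \<le> N i \<Longrightarrow> r (i, j) \<le> k * dsize (s i j) ^ k"
    using r' unfolding poly_bounded_def by fastforce
  obtain l where l: "\<And>i j. i \<in> I \<Longrightarrow> j < N i \<Longrightarrow> t (i, j) \<le> l * dsize (s i j) ^ l"
    using t' unfolding poly_bounded_def by fastforce
  define B where "B = (\<lambda>i. 1 + k * dsize (s i 0) ^ k + l * dsize (s i 0) ^ l)"
  have B: "poly_bounded I (\<lambda>i. s i 0) B"
    unfolding B_def by (intro poly_bounded_add poly_bounded_const; rule poly_boundedI) auto
  show ?thesis
  proof (rule computesI)
    fix i assume i: "i \<in> I"
    show "exec Q (While c p) (s i 0) (s i (N i))
        (\<Sum>j\<le>N i. 1 + r (i, j) + (if j < N i then t (i, j) else 0)) 0"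
      using r[OF i] t[OF i] by (rule exec_While_iterate)
  next
    have "poly_bounded I (\<lambda>i. s i 0) (\<lambda>i. (N i + 1) * B i)"
      by (intro poly_bounded_intros iterations B)
    then show "poly_bounded I (\<lambda>i. s i 0)
        (\<lambda>i. \<Sum>j\<le>N i. 1 + r (i, j) + (if j < N i then t (i, j) else 0))"
    proof (rule poly_bounded_mono)
      fix i assume i: "i \<in> I"
      have "1 + r (i, j) + (if j < N i then t (i, j) else 0) \<le> B i" if j: "j \<le> N i" for j
      proof -
        have "k * dsize (s i j) ^ k \<le> k * dsize (s i 0) ^ k" "l * dsize (s i j) ^ l \<le> l * dsize (s i 0) ^ l"
          using size[OF i j] by (intro mult_left_mono power_mono; simp)+
        moreover have "(if j < N i then t (i, j) else 0) \<le> l * dsize (s i j) ^ l"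
          using l[OF i] by simp
        ultimately show ?thesis
          using k[OF i j] unfolding B_def by linarith
      qed
      then have "(\<Sum>j\<le>N i. 1 + r (i, j) + (if j < N i then t (i, j) else 0)) \<le> (\<Sum>j\<le>N i. B i)"
        by (intro sum_mono) auto
      then show "(\<Sum>j\<le>N i. 1 + r (i, j) + (if j < N i then t (i, j) else 0)) \<le> (N i + 1) * B i"
        by simp
    qed simp
  qed
qed

section \<open>Oracle-free programs in the presence of an oracle\<close>

lemma exec_no_oracle: "exec no_oracle p v w t n \<Longrightarrow> exec Q p v w t n"
  \<comment> \<open>An \<open>Ask\<close> to \<open>no_oracle\<close> never succeeds, so its case is
    vacuous.\<close>
  by (induction rule: exec.induct) (blast intro: exec.intros, simp add: no_oracle_def, (blast intro: exec.intros)+)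

text \<open>A problem may allow several answers, but a deterministic program picks one of them;
  \<open>g\<close> is this choice. As a function it lets later outputs be written as explicit terms,
  and the runs are available with every oracle.\<close>

lemma poly_time_solvable_function:
  assumes "poly_time_solvable P"
  shows "\<exists>p g. (\<forall>v A. (v, A) \<in> P \<longrightarrow> g v \<in> A) \<and>
    (\<forall>Q (I :: 'i set) f. (\<forall>i\<in>I. \<exists>A. (f i, A) \<in> P) \<longrightarrow> computes Q 0 p I f (\<lambda>i. g (f i)))"
proof -
  obtain p k where "\<forall>(v, A)\<in>P. \<exists>w\<in>A. \<exists>t. exec no_oracle p v w t 0 \<and> t \<le> k * dsize v ^ k"
    using assms unfolding poly_time_solvable_def solves_in_poly_time_def by (elim exE)
  then have k: "\<exists>w\<in>A. \<exists>t. exec no_oracle p v w t 0 \<and> t \<le> k * dsize v ^ k" if "(v, A) \<in> P" for v A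
    using that by auto
  \<comment> \<open>Determinism makes the output unique; on inputs without a terminating run the
    value is arbitrary.\<close>
  define g where "g = (\<lambda>v. THE w. \<exists>t. exec no_oracle p v w t 0)"
  have g: "g v = w" if "exec no_oracle p v w t 0" for v w t
    unfolding g_def
  proof (rule the_equality)
    show "w' = w" if "\<exists>t. exec no_oracle p v w' t 0" for w'
      using that exec_deterministic[OF _ \<open>exec no_oracle p v w t 0\<close>, of w']
      by (auto simp: no_oracle_def)
  qed (use that in blast)
  show ?thesis
  proof (intro exI[of _ p] exI[of _ g] conjI allI impI)
    show "g v \<in> A" if "(v, A) \<in> P" for v A
    proof -
      from k[OF that] obtain w t where "w \<in> A" "exec no_oracle p v w t 0" by blast
      with g show ?thesis by simp
    qed
    fix Q and I :: "'i set" and f assume f: "\<forall>i\<in>I. \<exists>A. (f i, A) \<in> P"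
    have "\<exists>t. exec Q p (f i) (g (f i)) t 0 \<and> t \<le> k * dsize (f i) ^ k" if "i \<in> I" for i
    proof -
      from bspec[OF f that] obtain A where "(f i, A) \<in> P" ..
      from k[OF this] obtain w t where "exec no_oracle p (f i) w t 0" "t \<le> k * dsize (f i) ^ k"
        by blast
      with g[OF this(1)] exec_no_oracle[OF this(1)] show ?thesis by auto
    qed
    then have "\<forall>i\<in>I. \<exists>t. exec Q p (f i) (g (f i)) t 0 \<and> t \<le> k * dsize (f i) ^ k"
      by blast
    then obtain t where "\<forall>i\<in>I. exec Q p (f i) (g (f i)) (t i) 0 \<and> t i \<le> k * dsize (f i) ^ k"
      unfolding bchoice_iff by blast
    then show "computes Q 0 p I f (\<lambda>i. g (f i))"
      by (intro computesI[where t = t] poly_boundedI[where c = k and e = k]) auto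
  qed
qed

section \<open>Necessity and model counting\<close>

lemma entities_upd: "e \<in> entities X D \<Longrightarrow> x \<in> X \<Longrightarrow> b \<in> D x \<Longrightarrow> e(x := b) \<in> entities X D"
  unfolding entities_def by (auto simp: PiE_iff extensional_def)

lemma finite_entities: "feature_space X D \<Longrightarrow> finite (entities X D)"
  unfolding entities_def feature_space_def by (auto intro: finite_PiE)

lemma sufficient_reason_within:
  assumes "finite S" "is_reason X D M e S"
  shows "\<exists>T\<subseteq>S. is_sufficient_reason X D M e T"
  using assms
proof (induction S rule: finite_psubset_induct)
  case (psubset S)
  show ?case
  proof (cases "is_sufficient_reason X D M e S")
    case False
    then obtain T where "T \<subset> S" "is_reason X D M e T"
      using psubset.prems by (auto simp: is_sufficient_reason_def)
    with psubset.IH[of T] show ?thesis by blast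
  qed blast
qed

lemma necessary_iff:
  assumes "finite X" "e \<in> entities X D" "x \<in> X"
  shows "necessary X D M e x \<longleftrightarrow> (\<exists>b\<in>D x. M (e(x := b)) \<noteq> M e)"
proof -
  have "necessary X D M e x \<longleftrightarrow> \<not> is_reason X D M e (X - {x})"
  proof
    \<comment> \<open>If \<open>X - {x}\<close> were a reason, it would contain a sufficient reason,
      and that one would omit \<open>x\<close>.\<close>
    assume "necessary X D M e x"
    then show "\<not> is_reason X D M e (X - {x})"
      using sufficient_reason_within[of "X - {x}" X D M e] assms(1) by (auto simp: necessary_def)
  next
    assume *: "\<not> is_reason X D M e (X - {x})"
    \<comment> \<open>A reason without \<open>x\<close> lies in \<open>X - {x}\<close>, and
      enlarging a reason inside \<open>X\<close> gives a reason again.\<close>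
    have "x \<in> S" if "is_reason X D M e S" for S
      using * that unfolding is_reason_def by blast
    then show "necessary X D M e x"
      by (auto simp: necessary_def is_sufficient_reason_def)
  qed
  also have "\<dots> \<longleftrightarrow> (\<exists>b\<in>D x. M (e(x := b)) \<noteq> M e)"
  proof
    assume "\<not> is_reason X D M e (X - {x})"
    then obtain e' where e': "e' \<in> entities X D" "\<forall>y\<in>X - {x}. e' y = e y" "M e' \<noteq> M e"
      by (auto simp: is_reason_def)
    \<comment> \<open>Both entities are extensional, so agreement on \<open>X - {x}\<close> leaves
      only the value at \<open>x\<close> free.\<close>
    have "e' = e(x := e' x)"
      using e'(1,2) assms(2) by (fastforce simp: entities_def PiE_iff extensional_def)
    moreover have "e' x \<in> D x"
      using e'(1) assms(3) by (auto simp: entities_def)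
    ultimately show "\<exists>b\<in>D x. M (e(x := b)) \<noteq> M e"
      using e'(3) by metis
  next
    assume "\<exists>b\<in>D x. M (e(x := b)) \<noteq> M e"
    then obtain b where b: "b \<in> D x" "M (e(x := b)) \<noteq> M e" by blast
    moreover have "e(x := b) \<in> entities X D"
      using assms b by (intro entities_upd)
    moreover have "\<forall>y\<in>X - {x}. (e(x := b)) y = e y"
      by auto
    ultimately show "\<not> is_reason X D M e (X - {x})"
      unfolding is_reason_def by blast
  qed
  finally show ?thesis .
qed

lemma card_necessary:
  assumes "feature_space X D" "x \<in> X"
    and A: "\<And>e. e \<in> entities X D \<Longrightarrow> A e \<longleftrightarrow> M e \<and> (\<forall>b\<in>D x. M (e(x := b)))"
    and B: "\<And>e. e \<in> entities X D \<Longrightarrow> B e \<longleftrightarrow> M e \<or> (\<exists>b\<in>D x. M (e(x := b)))"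
  shows "card {e \<in> entities X D. necessary X D M e x} = CT X D B - CT X D A"
proof -
  have fin: "finite X" using assms(1) by (simp add: feature_space_def)
  \<comment> \<open>\<open>B e\<close> without \<open>A e\<close> says that \<open>M\<close> takes
    both values on \<open>e\<close> and its changes at \<open>x\<close>, so one of these changes has
    a value other than \<open>M e\<close>.\<close>
  have "necessary X D M e x \<longleftrightarrow> B e \<and> \<not> A e" if e: "e \<in> entities X D" for e
  proof -
    have "e x \<in> D x" "e(x := e x) = e"
      using e assms(2) by (auto simp: entities_def)
    then show ?thesis
      unfolding necessary_iff[OF fin e assms(2)] A[OF e] B[OF e] by metis
  qed
  then have "{e \<in> entities X D. necessary X D M e x} = {e \<in> entities X D. B e} - {e \<in> entities X D. A e}"
    by blast
  \<comment> \<open>This inclusion makes the truncated subtraction of the counts exact.\<close>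
  moreover have "{e \<in> entities X D. A e} \<subseteq> {e \<in> entities X D. B e}"
    using A B by blast
  ultimately show ?thesis
    unfolding CT_def using finite_entities[OF assms(1)] by (simp add: card_Diff_subset)
qed

section \<open>Size of the oracle's answers\<close>

lemma length_le_dsize: "length vs \<le> dsize (enc_list vs)"
  by (induction vs) auto

lemma enc_list_eq_Atom_iff: "enc_list vs = Atom n \<longleftrightarrow> vs = [] \<and> n = 0"
  by (cases vs) auto

text \<open>A domain has at most as many values as the size of its encoding, and
  \<open>n \<le> 2 ^ n\<close>. The encodings add up in the exponent while the cardinalities
  multiply.\<close>

lemma prod_card_le:
  assumes "\<And>x. x \<in> set xs \<Longrightarrow> finite (D x)"
  shows "(\<Prod>x\<leftarrow>xs. card (D x)) \<le>
    2 ^ dsize (enc_list (map (\<lambda>x. Node (Atom x) (enc_list (map Atom (sorted_list_of_set (D x))))) xs))"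
  using assms
proof (induction xs)
  case (Cons x xs)
  let ?l = "enc_list (map Atom (sorted_list_of_set (D x)))"
  have "card (D x) \<le> dsize ?l"
    using length_le_dsize[of "map Atom (sorted_list_of_set (D x))"] by simp
  also have "\<dots> \<le> 2 ^ dsize ?l" by (simp add: less_imp_le)
  finally have "card (D x) * (\<Prod>x\<leftarrow>xs. card (D x)) \<le> 2 ^ dsize ?l *
    2 ^ dsize (enc_list (map (\<lambda>x. Node (Atom x) (enc_list (map Atom (sorted_list_of_set (D x))))) xs))"
    using Cons by (intro mult_mono) auto
  also have "\<dots> \<le> 2 ^ dsize (enc_list (map (\<lambda>x. Node (Atom x) (enc_list (map Atom (sorted_list_of_set (D x))))) (x # xs)))"
    unfolding power_add[symmetric] by (rule power_increasing) auto
  finally show ?case by simp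
qed simp

text \<open>A call is also charged for its answer. The number of entities is at most exponential in
  the size of the space, so in binary the answer has linear size.\<close>

lemma dsize_CT:
  assumes "feature_space X D"
  shows "dsize (Atom (CT X D M)) \<le> 2 + dsize (enc_space X D)"
proof -
  have fin: "finite X" "\<And>x. x \<in> X \<Longrightarrow> finite (D x)"
    using assms by (auto simp: feature_space_def)
  have "CT X D M \<le> card (entities X D)"
    unfolding CT_def using finite_entities[OF assms] by (intro card_mono) auto
  also have "\<dots> = (\<Prod>x\<leftarrow>sorted_list_of_set X. card (D x))"
    using fin by (simp add: entities_def card_PiE prod.distinct_set_conv_list[symmetric])
  also have "\<dots> \<le> 2 ^ dsize (enc_space X D)"
    unfolding enc_space_def using fin by (intro prod_card_le) auto
  \<comment> \<open>A number that is at most \<open>2 ^ n\<close> is strictly below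
    \<open>2 ^ Suc n\<close>, whence the \<open>Suc\<close>.\<close>
  finally have "floorlog 2 (CT X D M) \<le> Suc (dsize (enc_space X D))"
    by (intro floorlog_leI) (auto intro: le_less_trans)
  then show ?thesis by simp
qed

text \<open>A query is answered only if it is an instance of model counting, so it has to carry an
  admissible code; \<open>dsize_CT\<close> bounds the cost of the answer.\<close>

lemma computes_Ask:
  assumes "\<And>i. i \<in> I \<Longrightarrow> feature_space (X i) (D i) \<and> m i \<in> codes \<M> (X i) (D i)"
  shows "computes (oracle_for (model_counting \<M>)) 1 Ask I (\<lambda>i. Node (enc_space (X i) (D i)) (m i))
    (\<lambda>i. Atom (CT (X i) (D i) (model \<M> (X i) (D i) (m i))))" (is "computes ?Q 1 Ask I ?f ?g")
proof (rule computesI)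
  show "exec ?Q Ask (?f i) (?g i) (1 + dsize (?f i) + dsize (?g i)) 1" if "i \<in> I" for i
    using assms[OF that] by (intro exec.Ask) (auto simp: oracle_for_def model_counting_def)
  have "poly_bounded I ?f (\<lambda>i. 1 + dsize (?f i) + (2 + dsize (?f i)))"
    by (intro poly_bounded_intros)
  then show "poly_bounded I ?f (\<lambda>i. 1 + dsize (?f i) + dsize (?g i))"
  proof (rule poly_bounded_mono)
    show "1 + dsize (?f i) + dsize (?g i) \<le> 1 + dsize (?f i) + (2 + dsize (?f i))" if "i \<in> I" for i
      using dsize_CT[of "X i" "D i" "model \<M> (X i) (D i) (m i)"] assms[OF that] by auto
  qed simp
qed

section \<open>The program\<close>

text \<open>The state is the rest of an association list together with the key, and a round drops
  the first entry. The end of the list is not tested, since the loop is only run for a key that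
  occurs.\<close>

definition lookup_loop :: program where
  "lookup_loop = While
     (negate (Seq (Fork (Seq (Basic Lft) (Seq (Basic Lft) (Basic Lft))) (Basic Rgt)) (Basic Equal)))
     (Fork (Seq (Basic Lft) (Basic Rgt)) (Basic Rgt))"

definition lookup :: program where
  "lookup = Seq lookup_loop (Seq (Basic Lft) (Seq (Basic Lft) (Basic Rgt)))"

abbreviation enc_alist :: "(nat \<times> datum) list \<Rightarrow> datum" where
  "enc_alist l \<equiv> enc_list (map (\<lambda>(y, v). Node (Atom y) v) l)"

lemma dsize_enc_list_drop: "dsize (enc_list (drop j vs)) \<le> dsize (enc_list vs)"
proof (induction vs arbitrary: j)
  case (Cons v vs)
  show ?case
  proof (cases j)
    case (Suc k)
    then show ?thesis using Cons.IH[of k] by simp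
  qed simp
qed simp

lemma the_map_of_eq_nth:
  "x \<in> fst ` set l \<Longrightarrow> the (map_of l x) = snd (l ! length (takeWhile (\<lambda>a. fst a \<noteq> x) l))"
  by (induction l) auto

text \<open>The position of the key need not be bounded over \<open>I\<close>, but the states only
  shrink, so \<open>computes_While_iterate\<close> applies.\<close>

lemma computes_lookup:
  assumes x: "\<And>i. i \<in> I \<Longrightarrow> x i \<in> fst ` set (l i)"
  shows "computes Q 0 lookup I (\<lambda>i. Node (enc_alist (l i)) (Atom (x i))) (\<lambda>i. the (map_of (l i) (x i)))"
proof -
  define N where "N = (\<lambda>i. length (takeWhile (\<lambda>a. fst a \<noteq> x i) (l i)))"
  define s where "s = (\<lambda>i j. Node (enc_alist (drop j (l i))) (Atom (x i)))"
  have N_less: "N i < length (l i)" if "i \<in> I" for i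
  proof -
    have "takeWhile (\<lambda>a. fst a \<noteq> x i) (l i) \<noteq> l i"
      using x[OF that] by force
    then show ?thesis
      unfolding N_def by (metis length_takeWhile_le le_neq_implies_less take_all_iff takeWhile_eq_take order_refl)
  qed
  \<comment> \<open>This covers \<open>j = N i\<close> too, where the test has to stop the
    loop.\<close>
  have nth: "fst (l i ! j) \<noteq> x i \<longleftrightarrow> j < N i" if "i \<in> I" "j \<le> N i" for i j
  proof (cases "j = N i")
    case True
    then show ?thesis
      using nth_length_takeWhile[of "\<lambda>a. fst a \<noteq> x i" "l i"] N_less[OF that(1)] by (simp add: N_def)
  next
    case False
    then have j: "j < length (takeWhile (\<lambda>a. fst a \<noteq> x i) (l i))"
      using that(2) by (simp add: N_def)
    then have "fst (takeWhile (\<lambda>a. fst a \<noteq> x i) (l i) ! j) \<noteq> x i"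
      using nth_mem set_takeWhileD by fastforce
    with j show ?thesis
      by (simp add: takeWhile_nth N_def)
  qed
  have s: "s i j = Node (Node (Node (Atom (fst (l i ! j))) (snd (l i ! j))) (enc_alist (drop (Suc j) (l i)))) (Atom (x i))"
    if "i \<in> I" "j \<le> N i" for i j
    using that N_less[OF that(1)] unfolding s_def
    by (simp add: Cons_nth_drop_Suc[symmetric] split_beta)
  \<comment> \<open>The states with their first entry split off and with a pair as index, a form
    that the rules for \<open>Lft\<close> and \<open>Rgt\<close> can match.\<close>
  let ?s = "\<lambda>ij. Node (Node (Node (Atom (fst (l (fst ij) ! snd ij))) (snd (l (fst ij) ! snd ij)))
      (enc_alist (drop (Suc (snd ij)) (l (fst ij))))) (Atom (x (fst ij)))"
  have loop: "computes Q 0 lookup_loop I (\<lambda>i. s i 0) (\<lambda>i. s i (N i))"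
    unfolding lookup_loop_def
  proof (rule computes_While_iterate)
    let ?J = "{(i, j). i \<in> I \<and> j \<le> N i}"
    have "computes Q 0
        (negate (Seq (Fork (Seq (Basic Lft) (Seq (Basic Lft) (Basic Lft))) (Basic Rgt)) (Basic Equal)))
        ?J ?s (\<lambda>ij. Atom (of_bool (\<not> Atom (fst (l (fst ij) ! snd ij)) = Atom (x (fst ij)))))"
      by (rule computes_intros)+
    then show "computes Q 0
        (negate (Seq (Fork (Seq (Basic Lft) (Seq (Basic Lft) (Basic Lft))) (Basic Rgt)) (Basic Equal)))
        ?J (\<lambda>(i, j). s i j) (\<lambda>(i, j). Atom (of_bool (j < N i)))"
      by (rule computes_cong) (auto simp: s nth[symmetric])
    have "computes Q 0 (Fork (Seq (Basic Lft) (Basic Rgt)) (Basic Rgt)) {(i, j). i \<in> I \<and> j < N i} ?s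
        (\<lambda>ij. Node (enc_alist (drop (Suc (snd ij)) (l (fst ij)))) (Atom (x (fst ij))))"
      by (rule computes_intros)+
    then show "computes Q 0 (Fork (Seq (Basic Lft) (Basic Rgt)) (Basic Rgt)) {(i, j). i \<in> I \<and> j < N i}
        (\<lambda>(i, j). s i j) (\<lambda>(i, j). s i (Suc j))"
    proof (rule computes_cong)
      show "(\<lambda>(i, j). s i j) ij = ?s ij" if "ij \<in> {(i, j). i \<in> I \<and> j < N i}" for ij
        using that s by auto
    qed (auto simp: s_def)
    show "dsize (s i j) \<le> dsize (s i 0)" for i j
      unfolding s_def using dsize_enc_list_drop[of j "map (\<lambda>(y, v). Node (Atom y) v) (l i)"]
      by (simp add: drop_map)
    show "poly_bounded I (\<lambda>i. s i 0) N"
      using poly_bounded_dsize[of I "\<lambda>i. s i 0"]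
    proof (rule poly_bounded_mono)
      show "N i \<le> dsize (s i 0)" if "i \<in> I" for i
        using N_less[OF that] length_le_dsize[of "map (\<lambda>(y, v). Node (Atom y) v) (l i)"]
        by (simp add: s_def)
    qed simp
  qed
  have eq: "the (map_of (l i) (x i)) = snd (l i ! N i)" if "i \<in> I" for i
    unfolding N_def using x[OF that] by (rule the_map_of_eq_nth)
  have "computes Q 0 (Seq (Basic Lft) (Seq (Basic Lft) (Basic Rgt))) I (\<lambda>i. ?s (i, N i))
      (\<lambda>i. snd (l i ! N i))"
    unfolding fst_conv snd_conv by (rule computes_intros)+
  then have "computes Q 0 (Seq (Basic Lft) (Seq (Basic Lft) (Basic Rgt))) I (\<lambda>i. s i (N i))
      (\<lambda>i. the (map_of (l i) (x i)))"
    by (rule computes_cong) (auto simp: s eq)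
  with loop have "computes Q 0 lookup I (\<lambda>i. s i 0) (\<lambda>i. the (map_of (l i) (x i)))"
    unfolding lookup_def by (rule computes_Seq0)
  then show ?thesis
    by (simp add: s_def)
qed

text \<open>
  In a state of the loop, \<open>bs\<close> are the values still to be treated and \<open>a\<close> is the conjunction
  built so far.
\<close>

definition loop_state :: "nat set \<Rightarrow> (nat \<Rightarrow> nat set) \<Rightarrow> datum \<Rightarrow> nat \<Rightarrow> nat list \<Rightarrow> datum \<Rightarrow> datum" where
  "loop_state X D m x bs a = Node (enc_list (map Atom bs))
     (Node (Node (enc_space X D) m) (Node (Atom x) a))"

definition all_values_test :: program where
  "all_values_test = negate (Seq (Fork (Basic Lft) (Basic (Const (Atom 0)))) (Basic Equal))"

text \<open>Rebuilds a \<open>loop_state\<close>. Only the remaining values and the accumulator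
  change: \<open>pc\<close> conditions the original model \<open>m\<close>, not the accumulator, on
  the first value, and \<open>pa\<close> conjoins the result to the accumulator.\<close>

definition all_values_step :: "program \<Rightarrow> program \<Rightarrow> program" where
  "all_values_step pc pa =
    Fork (Seq (Basic Lft) (Basic Rgt)) (Fork (Seq (Basic Rgt) (Basic Lft))
       (Fork (Seq (Basic Rgt) (Seq (Basic Rgt) (Basic Lft)))
         (Seq (Fork (Seq (Basic Rgt) (Seq (Basic Lft) (Basic Lft)))
           (Fork (Seq (Basic Rgt) (Seq (Basic Rgt) (Basic Rgt)))
             (Seq (Fork (Seq (Basic Rgt) (Basic Lft))
               (Fork (Seq (Basic Rgt) (Seq (Basic Rgt) (Basic Lft))) (Seq (Basic Lft) (Basic Lft)))) pc)))
          pa)))"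

definition all_values_loop :: "program \<Rightarrow> program \<Rightarrow> program" where
  "all_values_loop pc pa = While all_values_test (all_values_step pc pa)"

text \<open>The input holds the values, then the space with \<open>m\<close>, then the feature. The
  accumulator starts as a copy of \<open>m\<close> and is projected out at the end.\<close>

definition all_values :: "program \<Rightarrow> program \<Rightarrow> program" where
  "all_values pc pa = Seq
     (Seq (Fork (Basic Lft) (Fork (Seq (Basic Rgt) (Basic Lft))
        (Fork (Seq (Basic Rgt) (Basic Rgt)) (Seq (Basic Rgt) (Seq (Basic Lft) (Basic Rgt))))))
       (all_values_loop pc pa))
     (Seq (Basic Rgt) (Seq (Basic Rgt) (Basic Rgt)))"

text \<open>The exact code that the loop ends with. The fold is over codes, as a model may have
  several and the closure programs choose among them.\<close>

definition conj_values ::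
    "(datum \<Rightarrow> datum) \<Rightarrow> (datum \<Rightarrow> datum) \<Rightarrow> datum \<Rightarrow> datum \<Rightarrow> nat \<Rightarrow> datum \<Rightarrow> nat list \<Rightarrow> datum" where
  "conj_values cond_code conj_code S m x =
     foldl (\<lambda>a b. conj_code (Node S (Node a (cond_code (Node (Node S m) (Node (Atom x) (Atom b)))))))"

definition all_query :: "program \<Rightarrow> program \<Rightarrow> program" where
  "all_query pc pa =
     Seq (Fork (Seq (Basic Rgt) (Seq (Basic Lft) (Basic Lft))) (all_values pc pa)) Ask"

text \<open>Negates \<open>m\<close>, conjoins over all values and negates again: by De Morgan, this
  asks about acceptance for some value.\<close>

definition some_query :: "program \<Rightarrow> program \<Rightarrow> program \<Rightarrow> program" where
  "some_query pc pn pa = Seq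
     (Seq
       (Fork (Basic Lft)
         (Fork
           (Fork (Seq (Basic Rgt) (Seq (Basic Lft) (Basic Lft))) (Seq (Seq (Basic Rgt) (Basic Lft)) pn))
           (Seq (Basic Rgt) (Basic Rgt))))
       (Fork (Seq (Basic Rgt) (Seq (Basic Lft) (Basic Lft)))
         (Seq (Fork (Seq (Basic Rgt) (Seq (Basic Lft) (Basic Lft))) (all_values pc pa)) pn)))
     Ask"

text \<open>The values of \<open>x\<close> are read off the encoded space once and paired with the
  input. Both calls lie outside the loop, so there are exactly two whatever the domain.\<close>

definition necessity :: "program \<Rightarrow> program \<Rightarrow> program \<Rightarrow> program" where
  "necessity pc pn pa = Seq
     (Fork (Seq (Fork (Seq (Basic Lft) (Basic Lft)) (Basic Rgt)) lookup) (Basic Copy))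
     (Seq (Fork (some_query pc pn pa) (all_query pc pa)) (Basic Minus))"

text \<open>
  The assumptions of a locale are monomorphic in types, so \<open>index_type\<close> fixes the type that
  indexes the families of runs.
\<close>

locale closed_class =
  fixes \<M> :: model_class
    and cond_prog neg_prog conj_prog :: program
    and cond_code neg_code conj_code :: "datum \<Rightarrow> datum"
    and index_type :: "'i itself"
  assumes cond: "\<And>X D m x b. feature_space X D \<Longrightarrow> m \<in> codes \<M> X D \<Longrightarrow> x \<in> X \<Longrightarrow> b \<in> D x \<Longrightarrow>
      cond_code (Node (Node (enc_space X D) m) (Node (Atom x) (Atom b)))
        \<in> codes_of \<M> X D (condition (model \<M> X D m) x b)"
    and neg: "\<And>X D m. feature_space X D \<Longrightarrow> m \<in> codes \<M> X D \<Longrightarrow>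
      neg_code (Node (enc_space X D) m) \<in> codes_of \<M> X D (\<lambda>e. \<not> model \<M> X D m e)"
    and conj: "\<And>X D m1 m2. feature_space X D \<Longrightarrow> m1 \<in> codes \<M> X D \<Longrightarrow> m2 \<in> codes \<M> X D \<Longrightarrow>
      conj_code (Node (enc_space X D) (Node m1 m2))
        \<in> codes_of \<M> X D (\<lambda>e. model \<M> X D m1 e \<and> model \<M> X D m2 e)"
    and computes_cond: "\<And>Q (I :: 'i set) X D m x b.
      (\<And>i. i \<in> I \<Longrightarrow> feature_space (X i) (D i) \<and> m i \<in> codes \<M> (X i) (D i) \<and> x i \<in> X i \<and> b i \<in> D i (x i)) \<Longrightarrow>
      computes Q 0 cond_prog I
        (\<lambda>i. Node (Node (enc_space (X i) (D i)) (m i)) (Node (Atom (x i)) (Atom (b i))))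
        (\<lambda>i. cond_code (Node (Node (enc_space (X i) (D i)) (m i)) (Node (Atom (x i)) (Atom (b i)))))"
    and computes_neg: "\<And>Q (I :: 'i set) X D m.
      (\<And>i. i \<in> I \<Longrightarrow> feature_space (X i) (D i) \<and> m i \<in> codes \<M> (X i) (D i)) \<Longrightarrow>
      computes Q 0 neg_prog I (\<lambda>i. Node (enc_space (X i) (D i)) (m i))
        (\<lambda>i. neg_code (Node (enc_space (X i) (D i)) (m i)))"
    and computes_conj: "\<And>Q (I :: 'i set) X D m1 m2.
      (\<And>i. i \<in> I \<Longrightarrow> feature_space (X i) (D i) \<and> m1 i \<in> codes \<M> (X i) (D i) \<and> m2 i \<in> codes \<M> (X i) (D i)) \<Longrightarrow>
      computes Q 0 conj_prog I (\<lambda>i. Node (enc_space (X i) (D i)) (Node (m1 i) (m2 i)))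
        (\<lambda>i. conj_code (Node (enc_space (X i) (D i)) (Node (m1 i) (m2 i))))"
begin

section \<open>Codes of the conjunctions and correctness of the count\<close>

abbreviation all_code :: "nat set \<Rightarrow> (nat \<Rightarrow> nat set) \<Rightarrow> datum \<Rightarrow> nat \<Rightarrow> datum" where
  "all_code X D m x \<equiv> conj_values cond_code conj_code (enc_space X D) m x m (sorted_list_of_set (D x))"

text \<open>The induction needs an arbitrary accumulator \<open>a\<close> denoting some
  \<open>N\<close>, since each round conjoins one more conditioned model to it.\<close>

lemma conj_values_codes:
  assumes "feature_space X D" "m \<in> codes \<M> X D" "x \<in> X"
    and "a \<in> codes_of \<M> X D N" "set bs \<subseteq> D x"
  shows "conj_values cond_code conj_code (enc_space X D) m x a bs
    \<in> codes_of \<M> X D (\<lambda>e. N e \<and> (\<forall>b\<in>set bs. model \<M> X D m (e(x := b))))"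
  using assms(4,5)
proof (induction bs arbitrary: a N)
  case Nil
  then show ?case by (simp add: conj_values_def)
next
  case (Cons b bs)
  let ?c = "cond_code (Node (Node (enc_space X D) m) (Node (Atom x) (Atom b)))"
  let ?a = "conj_code (Node (enc_space X D) (Node a ?c))"
  have c: "?c \<in> codes_of \<M> X D (condition (model \<M> X D m) x b)"
    using cond assms(1-3) Cons.prems(2) by simp
  have "?a \<in> codes_of \<M> X D (\<lambda>e. model \<M> X D a e \<and> model \<M> X D ?c e)"
    using c Cons.prems(1) assms(1) by (intro conj) (auto simp: codes_of_def)
  then have "?a \<in> codes_of \<M> X D (\<lambda>e. N e \<and> model \<M> X D m (e(x := b)))"
    using c Cons.prems(1) by (auto simp: codes_of_def same_model_def condition_def)
  from Cons.IH[OF this] Cons.prems(2) show ?case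
    by (simp add: conj_values_def)
qed

lemma all_code:
  assumes "feature_space X D" "m \<in> codes \<M> X D" "x \<in> X"
  shows "all_code X D m x
    \<in> codes_of \<M> X D (\<lambda>e. model \<M> X D m e \<and> (\<forall>b\<in>D x. model \<M> X D m (e(x := b))))"
proof -
  have "finite (D x)"
    using assms by (simp add: feature_space_def)
  then show ?thesis
    using conj_values_codes[OF assms, of m "model \<M> X D m" "sorted_list_of_set (D x)"] assms(2)
    by (simp add: codes_of_def same_model_def)
qed

lemma card_necessary_eq_diff:
  assumes "feature_space X D" "m \<in> codes \<M> X D" "x \<in> X"
  shows "card {e \<in> entities X D. necessary X D (model \<M> X D m) e x} =
    CT X D (model \<M> X D (neg_code (Node (enc_space X D) (all_code X D (neg_code (Node (enc_space X D) m)) x))))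
    - CT X D (model \<M> X D (all_code X D m x))"
proof (rule card_necessary[OF assms(1,3)])
  show "model \<M> X D (all_code X D m x) e \<longleftrightarrow>
      model \<M> X D m e \<and> (\<forall>b\<in>D x. model \<M> X D m (e(x := b)))" if "e \<in> entities X D" for e
    using all_code[OF assms] that by (simp add: codes_of_def same_model_def)
  let ?m = "neg_code (Node (enc_space X D) m)"
  let ?n = "all_code X D ?m x"
  have m: "?m \<in> codes_of \<M> X D (\<lambda>e. \<not> model \<M> X D m e)"
    using assms by (intro neg)
  then have n: "?n \<in> codes_of \<M> X D (\<lambda>e. model \<M> X D ?m e \<and> (\<forall>b\<in>D x. model \<M> X D ?m (e(x := b))))"
    using assms by (intro all_code) (auto simp: codes_of_def)
  then have "neg_code (Node (enc_space X D) ?n) \<in> codes_of \<M> X D (\<lambda>e. \<not> model \<M> X D ?n e)"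
    using assms by (intro neg) (auto simp: codes_of_def)
  \<comment> \<open>De Morgan. The codes are correct on entities only, so each
    \<open>e(x := b)\<close> has to be an entity.\<close>
  with m n show "model \<M> X D (neg_code (Node (enc_space X D) ?n)) e \<longleftrightarrow>
      model \<M> X D m e \<or> (\<exists>b\<in>D x. model \<M> X D m (e(x := b)))" if "e \<in> entities X D" for e
    using that entities_upd[OF that assms(3)] by (simp add: codes_of_def same_model_def)
qed

section \<open>Running time of the program\<close>

text \<open>The accumulator may grow polynomially in every round, so the rounds are unfolded by
  \<open>computes_While\<close>, one for each step of the induction on \<open>n\<close>. That
  \<open>n\<close> bounds the lists of all of \<open>I\<close> at once keeps the time
  polynomial.\<close>

lemma computes_all_values_loop:
  fixes I :: "'i set"
  assumes "\<And>i. i \<in> I \<Longrightarrow> feature_space (X i) (D i) \<and> m i \<in> codes \<M> (X i) (D i) \<and> x i \<in> X i"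
    and "\<And>i. i \<in> I \<Longrightarrow> a i \<in> codes \<M> (X i) (D i)"
    and "\<And>i. i \<in> I \<Longrightarrow> set (bs i) \<subseteq> D i (x i) \<and> length (bs i) < n"
  shows "computes Q 0 (all_values_loop cond_prog conj_prog) I
    (\<lambda>i. loop_state (X i) (D i) (m i) (x i) (bs i) (a i))
    (\<lambda>i. loop_state (X i) (D i) (m i) (x i) []
      (conj_values cond_code conj_code (enc_space (X i) (D i)) (m i) (x i) (a i) (bs i)))"
  using assms
proof (induction n arbitrary: I a bs)
  case (0 I a bs)
  \<comment> \<open>The length bound is strict, so \<open>n = 0\<close> leaves no instances.\<close>
  then have "I = {}" by auto
  then show ?case by (simp add: computes_empty)
next
  case (Suc n I a bs)
  let ?S = "\<lambda>i. enc_space (X i) (D i)"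
  let ?J = "{i \<in> I. bs i \<noteq> []}"
  let ?c = "\<lambda>i. cond_code (Node (Node (?S i) (m i)) (Node (Atom (x i)) (Atom (hd (bs i)))))"
  let ?a = "\<lambda>i. conj_code (Node (?S i) (Node (a i) (?c i)))"
  have hd: "hd (bs i) \<in> D i (x i)" if "i \<in> ?J" for i
    using Suc.prems(3)[of i] that by (cases "bs i") auto
  have tl: "set (tl (bs i)) \<subseteq> D i (x i) \<and> length (tl (bs i)) < n" if "i \<in> ?J" for i
    using Suc.prems(3)[of i] that by (cases "bs i") auto
  have c: "?c i \<in> codes \<M> (X i) (D i)" if "i \<in> ?J" for i
    using cond[of "X i" "D i" "m i" "x i" "hd (bs i)"] Suc.prems(1)[of i] hd[OF that] that
    by (simp add: codes_of_def)
  have a: "?a i \<in> codes \<M> (X i) (D i)" if "i \<in> ?J" for i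
    using conj[of "X i" "D i" "a i" "?c i"] Suc.prems(1,2)[of i] c[OF that] that
    by (simp add: codes_of_def)
  have computes_c: "computes Q 0 cond_prog ?J
      (\<lambda>i. Node (Node (?S i) (m i)) (Node (Atom (x i)) (Atom (hd (bs i))))) ?c"
    using Suc.prems(1) hd by (intro computes_cond) auto
  have computes_a: "computes Q 0 conj_prog ?J (\<lambda>i. Node (?S i) (Node (a i) (?c i))) ?a"
    using Suc.prems(1,2) c by (intro computes_conj) auto
  show ?case
    unfolding all_values_loop_def
  proof (rule computes_While[where P = "\<lambda>i. bs i \<noteq> []"
        and f' = "\<lambda>i. loop_state (X i) (D i) (m i) (x i) (tl (bs i)) (?a i)"])
    have "computes Q 0 all_values_test I
        (\<lambda>i. Node (enc_list (map Atom (bs i))) (Node (Node (?S i) (m i)) (Node (Atom (x i)) (a i))))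
        (\<lambda>i. Atom (of_bool (\<not> enc_list (map Atom (bs i)) = Atom 0)))"
      unfolding all_values_test_def by (rule computes_intros)+
    then show "computes Q 0 all_values_test I
        (\<lambda>i. loop_state (X i) (D i) (m i) (x i) (bs i) (a i)) (\<lambda>i. Atom (of_bool (bs i \<noteq> [])))"
      by (rule computes_cong) (auto simp: loop_state_def enc_list_eq_Atom_iff)
  next
    \<comment> \<open>The list is written by its head and tail so that the projections match; on
      \<open>?J\<close> it is not empty.\<close>
    have "computes Q 0
     (all_values_step cond_prog conj_prog) ?J
        (\<lambda>i. Node (Node (Atom (hd (bs i))) (enc_list (map Atom (tl (bs i)))))
          (Node (Node (?S i) (m i)) (Node (Atom (x i)) (a i))))
        (\<lambda>i. Node (enc_list (map Atom (tl (bs i)))) (Node (Node (?S i) (m i)) (Node (Atom (x i)) (?a i))))"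
      unfolding all_values_step_def by (rule computes_intros computes_c computes_a)+
    then show "computes Q 0
     (all_values_step cond_prog conj_prog) ?J (\<lambda>i. loop_state (X i) (D i) (m i) (x i) (bs i) (a i))
        (\<lambda>i. loop_state (X i) (D i) (m i) (x i) (tl (bs i)) (?a i))"
    proof (rule computes_cong)
      fix i assume "i \<in> ?J"
      then show "loop_state (X i) (D i) (m i) (x i) (bs i) (a i) =
          Node (Node (Atom (hd (bs i))) (enc_list (map Atom (tl (bs i)))))
            (Node (Node (?S i) (m i)) (Node (Atom (x i)) (a i)))"
        by (cases "bs i") (auto simp: loop_state_def)
    qed (auto simp: loop_state_def)
  next
    have "computes Q 0 (all_values_loop cond_prog conj_prog) ?J
        (\<lambda>i. loop_state (X i) (D i) (m i) (x i) (tl (bs i)) (?a i))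
        (\<lambda>i. loop_state (X i) (D i) (m i) (x i) []
          (conj_values cond_code conj_code (?S i) (m i) (x i) (?a i) (tl (bs i))))"
      using Suc.prems(1) a tl by (intro Suc.IH) auto
    then show "computes Q 0
      (While all_values_test
       (all_values_step cond_prog conj_prog)) ?J (\<lambda>i. loop_state (X i) (D i) (m i) (x i) (tl (bs i)) (?a i))
        (\<lambda>i. loop_state (X i) (D i) (m i) (x i) []
          (conj_values cond_code conj_code (?S i) (m i) (x i) (a i) (bs i)))"
      unfolding all_values_loop_def
      by (rule computes_cong) (auto simp: conj_values_def neq_Nil_conv)
  next
    fix i assume "i \<in> I" "\<not> bs i \<noteq> []"
    then show "loop_state (X i) (D i) (m i) (x i) []
        (conj_values cond_code conj_code (?S i) (m i) (x i) (a i) (bs i)) =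
        loop_state (X i) (D i) (m i) (x i) (bs i) (a i)"
      by (simp add: conj_values_def)
  qed
qed

lemma computes_all_values:
  fixes I :: "'i set"
  assumes I: "\<And>i. i \<in> I \<Longrightarrow> feature_space (X i) (D i) \<and> m i \<in> codes \<M> (X i) (D i) \<and> x i \<in> X i"
    and d: "\<And>i. i \<in> I \<Longrightarrow> card (D i (x i)) \<le> d"
  shows "computes Q 0 (all_values cond_prog conj_prog) I
    (\<lambda>i. Node (enc_list (map Atom (sorted_list_of_set (D i (x i)))))
      (Node (Node (enc_space (X i) (D i)) (m i)) (Atom (x i))))
    (\<lambda>i. all_code (X i) (D i) (m i) (x i))"
proof -
  have fin: "finite (D i (x i))" if "i \<in> I" for i
    using I[OF that] by (simp add: feature_space_def)
  have loop: "computes Q 0 (all_values_loop cond_prog conj_prog) I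
      (\<lambda>i. loop_state (X i) (D i) (m i) (x i) (sorted_list_of_set (D i (x i))) (m i))
      (\<lambda>i. loop_state (X i) (D i) (m i) (x i) [] (all_code (X i) (D i) (m i) (x i)))"
    \<comment> \<open>The list is as long as \<open>D i (x i)\<close> is large, and a strict bound
      is wanted: hence \<open>Suc d\<close>.\<close>
    using I d fin by (intro computes_all_values_loop[where n = "Suc d"]) (auto simp: less_Suc_eq_le)
  show ?thesis
    unfolding all_values_def
    by (rule computes_intros loop[unfolded loop_state_def])+
qed

lemma computes_lookup_space:
  fixes I :: "'i set"
  assumes I: "\<And>i. i \<in> I \<Longrightarrow> feature_space (X i) (D i) \<and> x i \<in> X i"
  shows "computes Q 0 lookup I (\<lambda>i. Node (enc_space (X i) (D i)) (Atom (x i)))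
    (\<lambda>i. enc_list (map Atom (sorted_list_of_set (D i (x i)))))"
proof -
  \<comment> \<open>The encoded space is an association list from features to encoded
    domains.\<close>
  define l where "l = (\<lambda>i. map (\<lambda>y. (y, enc_list (map Atom (sorted_list_of_set (D i y))))) (sorted_list_of_set (X i)))"
  have *: "x i \<in> set (sorted_list_of_set (X i))" if "i \<in> I" for i
    using I[OF that] by (simp add: feature_space_def)
  then have "computes Q 0 lookup I (\<lambda>i. Node (enc_alist (l i)) (Atom (x i))) (\<lambda>i. the (map_of (l i) (x i)))"
    by (intro computes_lookup) (force simp: l_def)
  then show ?thesis
  proof (rule computes_cong)
    show "enc_list (map Atom (sorted_list_of_set (D i (x i)))) = the (map_of (l i) (x i))" if "i \<in> I" for i
      using *[OF that] by (simp add: l_def map_of_map_restrict)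
  qed (simp_all add: l_def enc_space_def comp_def)
qed

lemma computes_necessity:
  fixes I :: "'i set"
  assumes I: "\<And>i. i \<in> I \<Longrightarrow> feature_space (X i) (D i) \<and> m i \<in> codes \<M> (X i) (D i) \<and> x i \<in> X i"
    and d: "\<And>i. i \<in> I \<Longrightarrow> card (D i (x i)) \<le> d"
  shows "computes (oracle_for (model_counting \<M>)) 2 (necessity cond_prog neg_prog conj_prog) I
    (\<lambda>i. Node (Node (enc_space (X i) (D i)) (m i)) (Atom (x i)))
    (\<lambda>i. Atom (card {e \<in> entities (X i) (D i). necessary (X i) (D i) (model \<M> (X i) (D i) (m i)) e (x i)}))"
proof -
  let ?Q = "oracle_for (model_counting \<M>)"
  let ?S = "\<lambda>i. enc_space (X i) (D i)"
  let ?neg = "\<lambda>i. neg_code (Node (?S i) (m i))"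
  let ?all = "\<lambda>i. all_code (X i) (D i) (m i) (x i)"
  let ?all_neg = "\<lambda>i. all_code (X i) (D i) (?neg i) (x i)"
  let ?some = "\<lambda>i. neg_code (Node (?S i) (?all_neg i))"
  have neg_m: "?neg i \<in> codes \<M> (X i) (D i)" if "i \<in> I" for i
    using neg[of "X i" "D i" "m i"] I[OF that] by (simp add: codes_of_def)
  have all: "?all i \<in> codes \<M> (X i) (D i)" if "i \<in> I" for i
    using all_code[of "X i" "D i" "m i" "x i"] I[OF that] by (simp add: codes_of_def)
  have all_neg: "?all_neg i \<in> codes \<M> (X i) (D i)" if "i \<in> I" for i
    using all_code[of "X i" "D i" "?neg i" "x i"] I[OF that] neg_m[OF that] by (simp add: codes_of_def)
  have some: "?some i \<in> codes \<M> (X i) (D i)" if "i \<in> I" for i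
    using neg[of "X i" "D i" "?all_neg i"] I[OF that] all_neg[OF that] by (simp add: codes_of_def)
  \<comment> \<open>Fixing the families here leaves only the encoded inputs and outputs to be
    matched. Apart from the lookup, each kind of run occurs for two codes.\<close>
  note runs =
    computes_lookup_space[where Q = ?Q and I = I and X = X and D = D and x = x]
    computes_neg[where Q = ?Q and I = I and X = X and D = D and m = m]
    computes_neg[where Q = ?Q and I = I and X = X and D = D and m = ?all_neg]
    computes_all_values[where Q = ?Q and I = I and X = X and D = D and x = x and m = m and d = d]
    computes_all_values[where Q = ?Q and I = I and X = X and D = D and x = x and m = ?neg and d = d]
    computes_Ask[where \<M> = \<M> and I = I and X = X and D = D and m = ?all]
    computes_Ask[where \<M> = \<M> and I = I and X = X and D = D and m = ?some]
  note prems = I d neg_m all all_neg some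
  let ?v = "\<lambda>i. Node (Node (?S i) (m i)) (Atom (x i))"
  let ?w = "\<lambda>i. Node (enc_list (map Atom (sorted_list_of_set (D i (x i))))) (?v i)"
  have w: "computes ?Q 0 (Fork (Seq (Fork (Seq (Basic Lft) (Basic Lft)) (Basic Rgt)) lookup) (Basic Copy)) I ?v ?w"
    by (rule computes_intros runs | (use prems in blast))+
  have q2: "computes ?Q 1 (some_query cond_prog neg_prog conj_prog) I ?w
      (\<lambda>i. Atom (CT (X i) (D i) (model \<M> (X i) (D i) (?some i))))"
    unfolding some_query_def by (rule computes_intros runs | (use prems in blast))+
  have q1: "computes ?Q 1 (all_query cond_prog conj_prog) I ?w
      (\<lambda>i. Atom (CT (X i) (D i) (model \<M> (X i) (D i) (?all i))))"
    unfolding all_query_def by (rule computes_intros runs | (use prems in blast))+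
  \<comment> \<open>One call in each branch of the fork, none elsewhere.\<close>
  have "computes ?Q 2 (necessity cond_prog neg_prog conj_prog) I ?v
      (\<lambda>i. Atom (CT (X i) (D i) (model \<M> (X i) (D i) (?some i)) - CT (X i) (D i) (model \<M> (X i) (D i) (?all i))))"
    using computes_Seq0[OF w computes_Seq[OF computes_Fork[OF q2 q1] computes_Minus]]
    by (simp add: necessity_def numeral_2_eq_2)
  then show ?thesis
    by (rule computes_cong) (use I in \<open>auto simp: card_necessary_eq_diff\<close>)
qed

end

section \<open>Necessity counting with two calls, for every bound on the domain size\<close>

theorem proposition24:
  fixes \<M> :: model_class
  assumes "closed_under_conditioning \<M>"
    and "closed_under_negation \<M>"
    and "closed_under_conjunction \<M>"
  shows "\<exists>p. \<forall>d. solves_in_poly_time (oracle_for (model_counting \<M>)) 2 p (necessity_counting \<M> d)"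
proof -
  let ?C = "{(Node (Node (enc_space X D) m) (Node (Atom x) (Atom b)),
       codes_of \<M> X D (condition (model \<M> X D m) x b)) | X D m x b.
       feature_space X D \<and> m \<in> codes \<M> X D \<and> x \<in> X \<and> b \<in> D x}"
  obtain pc c where c: "\<forall>v A. (v, A) \<in> ?C \<longrightarrow> c v \<in> A"
    and pc: "\<forall>Q (I :: (nat set \<times> (nat \<Rightarrow> nat set) \<times> datum \<times> nat) set) f.
      (\<forall>i\<in>I. \<exists>A. (f i, A) \<in> ?C) \<longrightarrow> computes Q 0 pc I f (\<lambda>i. c (f i))"
    using poly_time_solvable_function[OF assms(1)[unfolded closed_under_conditioning_def]] by (elim exE conjE) (rule that)
  let ?N = "{(Node (enc_space X D) m, codes_of \<M> X D (\<lambda>e. \<not> model \<M> X D m e)) | X D m.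
       feature_space X D \<and> m \<in> codes \<M> X D}"
  obtain pn n where n: "\<forall>v A. (v, A) \<in> ?N \<longrightarrow> n v \<in> A"
    and pn: "\<forall>Q (I :: (nat set \<times> (nat \<Rightarrow> nat set) \<times> datum \<times> nat) set) f.
      (\<forall>i\<in>I. \<exists>A. (f i, A) \<in> ?N) \<longrightarrow> computes Q 0 pn I f (\<lambda>i. n (f i))"
    using poly_time_solvable_function[OF assms(2)[unfolded closed_under_negation_def]] by (elim exE conjE) (rule that)
  let ?A = "{(Node (enc_space X D) (Node m1 m2),
       codes_of \<M> X D (\<lambda>e. model \<M> X D m1 e \<and> model \<M> X D m2 e)) | X D m1 m2.
       feature_space X D \<and> m1 \<in> codes \<M> X D \<and> m2 \<in> codes \<M> X D}"
  obtain pa a where a: "\<forall>v A. (v, A) \<in> ?A \<longrightarrow> a v \<in> A"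
    and pa: "\<forall>Q (I :: (nat set \<times> (nat \<Rightarrow> nat set) \<times> datum \<times> nat) set) f.
      (\<forall>i\<in>I. \<exists>A. (f i, A) \<in> ?A) \<longrightarrow> computes Q 0 pa I f (\<lambda>i. a (f i))"
    using poly_time_solvable_function[OF assms(3)[unfolded closed_under_conjunction_def]] by (elim exE conjE) (rule that)
  interpret closed_class \<M> pc pn pa c n a "TYPE(nat set \<times> (nat \<Rightarrow> nat set) \<times> datum \<times> nat)"
  proof
    show "computes Q 0 pc I
        (\<lambda>i. Node (Node (enc_space (X i) (D i)) (m i)) (Node (Atom (x i)) (Atom (b i))))
        (\<lambda>i. c (Node (Node (enc_space (X i) (D i)) (m i)) (Node (Atom (x i)) (Atom (b i)))))"
      if "\<And>i. i \<in> I \<Longrightarrow> feature_space (X i) (D i) \<and> m i \<in> codes \<M> (X i) (D i) \<and> x i \<in> X i \<and> b i \<in> D i (x i)"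
      for Q and I :: "(nat set \<times> (nat \<Rightarrow> nat set) \<times> datum \<times> nat) set" and X D m x b
      by (rule pc[rule_format]) (use that in blast)
    show "computes Q 0 pn I (\<lambda>i. Node (enc_space (X i) (D i)) (m i))
        (\<lambda>i. n (Node (enc_space (X i) (D i)) (m i)))"
      if "\<And>i. i \<in> I \<Longrightarrow> feature_space (X i) (D i) \<and> m i \<in> codes \<M> (X i) (D i)"
      for Q and I :: "(nat set \<times> (nat \<Rightarrow> nat set) \<times> datum \<times> nat) set" and X D m
      by (rule pn[rule_format]) (use that in blast)
    show "computes Q 0 pa I (\<lambda>i. Node (enc_space (X i) (D i)) (Node (m1 i) (m2 i)))
        (\<lambda>i. a (Node (enc_space (X i) (D i)) (Node (m1 i) (m2 i))))"
      if "\<And>i. i \<in> I \<Longrightarrow> feature_space (X i) (D i) \<and> m1 i \<in> codes \<M> (X i) (D i) \<and> m2 i \<in> codes \<M> (X i) (D i)"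
      for Q and I :: "(nat set \<times> (nat \<Rightarrow> nat set) \<times> datum \<times> nat) set" and X D m1 m2
      by (rule pa[rule_format]) (use that in blast)
  qed (rule c[rule_format] n[rule_format] a[rule_format]; blast)+
  \<comment> \<open>The program is fixed before \<open>d\<close>; only the polynomial obtained for
    the family \<open>?I\<close> depends on \<open>d\<close>.\<close>
  have "solves_in_poly_time (oracle_for (model_counting \<M>)) 2 (necessity pc pn pa) (necessity_counting \<M> d)" for d
  proof -
    let ?I = "{(X, D, m, x). feature_space X D \<and> m \<in> codes \<M> X D \<and> x \<in> X \<and> card (D x) \<le> d}"
    have "computes (oracle_for (model_counting \<M>)) 2 (necessity pc pn pa) ?I
      (\<lambda>i. Node (Node (enc_space (fst i) (fst (snd i))) (fst (snd (snd i)))) (Atom (snd (snd (snd i)))))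
      (\<lambda>i. Atom (card {e \<in> entities (fst i) (fst (snd i)). necessary (fst i) (fst (snd i))
        (model \<M> (fst i) (fst (snd i)) (fst (snd (snd i)))) e (snd (snd (snd i)))}))"
      by (rule computes_necessity[where d = d]) auto
    then obtain t k where t: "\<And>X D m x. (X, D, m, x) \<in> ?I \<Longrightarrow>
        exec (oracle_for (model_counting \<M>)) (necessity pc pn pa) (Node (Node (enc_space X D) m) (Atom x))
          (Atom (card {e \<in> entities X D. necessary X D (model \<M> X D m) e x})) (t (X, D, m, x)) 2"
      and k: "\<And>X D m x. (X, D, m, x) \<in> ?I \<Longrightarrow>
        t (X, D, m, x) \<le> k * dsize (Node (Node (enc_space X D) m) (Atom x)) ^ k"
      unfolding computes_def poly_bounded_def by fastforce
    show ?thesis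
      unfolding solves_in_poly_time_def
    proof (intro exI[of _ k] ballI, clarify)
      fix v A assume "(v, A) \<in> necessity_counting \<M> d"
      then obtain X D m x where v: "v = Node (Node (enc_space X D) m) (Atom x)"
        "A = {Atom (card {e \<in> entities X D. necessary X D (model \<M> X D m) e x})}"
        and i: "(X, D, m, x) \<in> ?I"
        unfolding necessity_counting_def by blast
      show "\<exists>w\<in>A. \<exists>t. exec (oracle_for (model_counting \<M>)) (necessity pc pn pa) v w t 2 \<and> t \<le> k * dsize v ^ k"
        using t[OF i] k[OF i] unfolding v by blast
    qed
  qed
  then show ?thesis by blast
qed

end
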